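(* Let $q\geq4$ be even. Let $\pi$ be a plane of $\mathrm{PG}(5,q)$ containing no point of rank $1$ and such that the set of its points of rank at most $2$ is a nonempty projective subspace contained in the nucleus plane $\pi_{\mathcal{N}}$. Then $\pi$ is not contained in any solid of $\mathrm{PG}(5,q)$ of minimum rank $2$.
   Context: Identify points of $\mathrm{PG}(5,q)$ with nonzero symmetric $3\times3$ matrices over $\mathbb{F}_q$ up to nonzero scalars; projective subspaces correspond to $\mathbb{F}_q$-subspaces of symmetric matrices. The rank of a point is the rank of its matrix; a subspace has minimum rank $d$ if the smallest rank of its points is $d$. The nucleus plane $\pi_{\mathcal{N}}$ is the plane of matrices with zero main diagonal. A solid is a $3$-dimensional projective subspace. *)

theory Defs
  imports "HOL-Analysis.Analysis"
begin

definition scaleM :: "'a::field \<Rightarrow> 'a^'n^'m \<Rightarrow> 'a^'n^'m"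
  where "scaleM c A = (\<chi> i j. c * A $ i $ j)"

global_interpretation matvs: vector_space "scaleM :: 'a::field \<Rightarrow> 'a^'n^'m \<Rightarrow> 'a^'n^'m"
  by unfold_locales (simp_all add: scaleM_def vec_eq_iff algebra_simps)

text \<open>
  The projective space \<open>PG(5,q)\<close> is that of the six-dimensional vector space of symmetric
  \<open>3 \<times> 3\<close> matrices over the finite field \<open>'a\<close>. A projective subspace is represented by its
  underlying vector subspace, whose vector space dimension exceeds the projective one by one.
\<close>

definition pg_subspace :: "('a::field^3^3) set \<Rightarrow> bool"
  where "pg_subspace U \<longleftrightarrow> matvs.subspace U \<and> (\<forall>A\<in>U. transpose A = A)"

definition pg_plane :: "('a::field^3^3) set \<Rightarrow> bool"
  where "pg_plane U \<longleftrightarrow> pg_subspace U \<and> matvs.dim U = 3"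

definition pg_solid :: "('a::field^3^3) set \<Rightarrow> bool"
  where "pg_solid U \<longleftrightarrow> pg_subspace U \<and> matvs.dim U = 4"

definition pg_points :: "('a::field^3^3) set \<Rightarrow> ('a^3^3) set set"
  where "pg_points U = {matvs.span {A} | A. A \<in> U \<and> A \<noteq> 0}"

definition point_rank :: "('a::field^3^3) set \<Rightarrow> nat"
  where "point_rank P = (THE r. \<forall>A\<in>P. A \<noteq> 0 \<longrightarrow> rank A = r)"

definition has_min_rank :: "('a::field^3^3) set \<Rightarrow> nat \<Rightarrow> bool"
  where "has_min_rank U d \<longleftrightarrow>
    (\<exists>P\<in>pg_points U. point_rank P = d) \<and> (\<forall>P\<in>pg_points U. d \<le> point_rank P)"

definition nucleus_plane :: "('a::field^3^3) set"
  where "nucleus_plane = {A. transpose A = A \<and> (\<forall>i. A $ i $ i = 0)}"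

lemma rows_scaleM: "rows (scaleM c A) = (*s) c ` rows A"
proof -
  have "row i (scaleM c A) = c *s row i A" for i
    by (simp add: row_def scaleM_def vec_eq_iff)
  then show ?thesis
    by (auto simp: rows_def)
qed

lemma rank_scaleM:
  assumes "c \<noteq> 0"
  shows "rank (scaleM c A) = rank A"
proof -
  have "vec.span ((*s) c ` rows A) = vec.span (rows A)"
    using vec.span_image_scale[of "rows A" "\<lambda>_. c"] assms
    by (simp add: rows_def full_SetCompr_eq)
  then show ?thesis
    unfolding row_rank_def_gen rows_scaleM by (metis vec.dim_span)
qed

lemma point_rank_span:
  assumes "A \<noteq> 0"
  shows "point_rank (matvs.span {A}) = rank A"
  unfolding point_rank_def
proof (rule the_equality)
  show "\<forall>B\<in>matvs.span {A}. B \<noteq> 0 \<longrightarrow> rank B = rank A"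
    by (auto simp: matvs.span_singleton rank_scaleM)
next
  fix r
  assume "\<forall>B\<in>matvs.span {A}. B \<noteq> 0 \<longrightarrow> rank B = r"
  then show "r = rank A"
    using assms matvs.span_base[of A "{A}"] by auto
qed

end

theory Submission
  imports Defs
begin

text \<open>
  Write \<open>q = CARD('a)\<close>, and let \<open>S\<close> be a solid containing \<open>\<pi>\<close>. In characteristic 2 a nonzero
  point of the nucleus plane can be moved by a congruence to the matrix \<open>N\<close> (below \<open>hyp\<close>)
  whose only nonzero entries are the two at positions \<open>(1,2)\<close> and \<open>(2,1)\<close>.
  For \<open>M\<close> in \<open>\<pi>\<close>, \<open>det (M + t N) = det M + t\<^sup>2 M\<^sub>3\<^sub>3\<close> has a root \<open>t\<close> unless
  \<open>M\<^sub>3\<^sub>3 = 0\<close>; as singular matrices of \<open>\<pi>\<close> have zero diagonal,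
  \<open>M\<^sub>3\<^sub>3\<close> vanishes on \<open>\<pi>\<close>.

  If \<open>M\<^sub>3\<^sub>3\<close> vanishes on \<open>S\<close>, counting gives an element of \<open>S\<close> that is not a multiple of \<open>N\<close> and whose
  third row is zero; adding a multiple of \<open>N\<close> makes it of rank 1. Otherwise \<open>S\<close> contains \<open>R\<close>
  with \<open>R\<^sub>3\<^sub>3 = 1\<close>. The additive map \<open>M \<mapsto> (M\<^sub>1\<^sub>1 + M\<^sub>1\<^sub>3\<^sup>2, M\<^sub>2\<^sub>2 + M\<^sub>2\<^sub>3\<^sup>2)\<close> on \<open>\<pi>\<close> has
  singular matrices in its kernel, so the kernel consists of the \<open>q\<close> multiples of \<open>N\<close> and the
  map is onto. Hence some \<open>M + R + t N\<close> with \<open>M\<close> in \<open>\<pi>\<close> has the form \<open>v v\<^sup>T\<close>. In both cases \<open>S\<close>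
  contains a point of rank 1.
\<close>

section \<open>Finite fields of characteristic 2\<close>

lemma one_plus_one_if_even_card:
  assumes "even CARD('a::{field,finite})"
  shows "(1::'a) + 1 = 0"
proof -
  let ?A = "UNIV - {0::'a}"
  have card: "odd (card ?A)"
    using assms by (simp add: card_Diff_singleton)
  \<comment> \<open>Negation permutes the nonzero elements; as their number is odd, their nonzero
    product equals its own negative.\<close>
  have "(\<Prod>x\<in>?A. x) = (\<Prod>x\<in>?A. - x)"
    by (rule prod.reindex_bij_witness[of _ uminus uminus]) auto
  also have "\<dots> = (-1) ^ card ?A * (\<Prod>x\<in>?A. x)"
    using prod.distrib[of "\<lambda>_. -1" "\<lambda>x. x" ?A] by simp
  also have "\<dots> = - (\<Prod>x\<in>?A. x)"
    using card by simp
  finally have "(1 + 1) * (\<Prod>x\<in>?A. x) = 0"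
    by (simp add: distrib_right eq_neg_iff_add_eq_0)
  then show ?thesis
    by simp
qed

lemma add_self_char_2:
  assumes "(1::'a::field) + 1 = 0"
  shows "x + x = (0::'a)"
  using assms by (metis distrib_right mult_1 mult_zero_left)

lemma char_2_simps:
  fixes x y :: "'a::field"
  assumes "(1::'a) + 1 = 0"
  shows "x + x = 0" "x + (x + y) = y" "- x = x" "x - y = x + y" "(2::'a) = 0"
proof -
  have *: "z + z = 0" for z :: 'a
    by (rule add_self_char_2[OF assms])
  show "x + x = 0" "x + (x + y) = y" "- x = x" "(2::'a) = 0"
    using *[of x] *[of 1] by (simp_all add: neg_eq_iff_add_eq_0 flip: add.assoc)
  show "x - y = x + y"
    using *[of y] by (simp add: diff_eq_eq add.assoc)
qed

text \<open>In characteristic 2, \<open>y = - z\<close> already means \<open>y = z\<close>, so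
  squaring is injective, and finiteness makes it onto.\<close>

lemma square_surj_char_2:
  fixes x :: "'a::{field,finite}"
  assumes "(1::'a) + 1 = 0"
  obtains y where "y * y = x"
proof -
  have "inj (\<lambda>y::'a. y * y)"
  proof (rule injI)
    fix y z :: 'a
    assume "y * y = z * z"
    then have "(y - z) * (y + z) = 0"
      by (simp add: algebra_simps)
    then show "y = z"
      using add_self_char_2[OF assms, of z] by (auto simp: add_eq_0_iff2)
  qed
  then have "surj (\<lambda>y::'a. y * y)"
    by (simp add: finite_UNIV_inj_surj)
  then show ?thesis
    using that by (metis surjD)
qed

section \<open>Counting elements of subspaces\<close>

lemma card_le_card_image_times_card_kernel:
  fixes f :: "'b::ab_group_add \<Rightarrow> 'c::ab_group_add"
  assumes "finite A"
    and diff: "\<And>x y. x \<in> A \<Longrightarrow> y \<in> A \<Longrightarrow> x - y \<in> A \<and> f (x - y) = f x - f y"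
  shows "card A \<le> card (f ` A) * card {x \<in> A. f x = 0}"
proof -
  \<comment> \<open>\<open>?s x\<close> is a fixed representative of the fibre of \<open>x\<close>,
    so \<open>x\<close> is recovered from \<open>f x\<close> and the kernel element
    \<open>x - ?s x\<close>.\<close>
  let ?s = "\<lambda>x. inv_into A f (f x)"
  have s: "?s x \<in> A" "f (?s x) = f x" if "x \<in> A" for x
    using that by (simp_all add: inv_into_into f_inv_into_f)
  have "inj_on (\<lambda>x. (f x, x - ?s x)) A"
    by (rule inj_onI) auto
  moreover have "(\<lambda>x. (f x, x - ?s x)) ` A \<subseteq> f ` A \<times> {x \<in> A. f x = 0}"
    using diff s by auto
  ultimately have "card A \<le> card (f ` A \<times> {x \<in> A. f x = 0})"
    using assms(1) by (intro card_inj_on_le) auto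
  then show ?thesis
    by (simp add: card_cartesian_product)
qed

lemma card_span_independent:
  fixes B :: "('a::{field,finite}^'n^'m) set"
  assumes "matvs.independent B"
  shows "card (matvs.span B) = CARD('a) ^ card B"
proof -
  have "finite B"
    by simp
  then show ?thesis
    using assms
  proof (induction B rule: finite_induct)
    case empty
    then show ?case by simp
  next
    case (insert x B)
    then have ind: "matvs.independent B" and x: "x \<notin> matvs.span B"
      by (simp_all add: matvs.independent_insert)
    let ?f = "\<lambda>(c, y). scaleM c x + y"
    have "inj_on ?f (UNIV \<times> matvs.span B)"
    proof (rule inj_onI, clarify)
      fix c y d z
      assume yz: "y \<in> matvs.span B" "z \<in> matvs.span B"
        and eq: "scaleM c x + y = scaleM d x + z"
      then have "scaleM (c - d) x = z - y"
        by (simp add: matvs.scale_left_diff_distrib algebra_simps)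
      with yz have "scaleM (c - d) x \<in> matvs.span B"
        by (simp add: matvs.span_diff)
      \<comment> \<open>For \<open>c \<noteq> d\<close>, dividing by \<open>c - d\<close> would put
        \<open>x\<close> into the span of \<open>B\<close>.\<close>
      then have "c = d"
        using x matvs.span_scale[of "scaleM (c - d) x" B "inverse (c - d)"]
        by (cases "c = d") simp_all
      then show "c = d \<and> y = z"
        using eq by simp
    qed
    moreover have "?f ` (UNIV \<times> matvs.span B) = matvs.span (insert x B)"
    proof
      show "?f ` (UNIV \<times> matvs.span B) \<subseteq> matvs.span (insert x B)"
        using matvs.span_mono[OF subset_insertI, of B x]
        by (auto intro!: matvs.span_add matvs.span_scale intro: matvs.span_base)
      show "matvs.span (insert x B) \<subseteq> ?f ` (UNIV \<times> matvs.span B)"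
      proof
        fix v assume "v \<in> matvs.span (insert x B)"
        then obtain k where "v - scaleM k x \<in> matvs.span B"
          by (auto simp: matvs.span_insert)
        then show "v \<in> ?f ` (UNIV \<times> matvs.span B)"
          by (intro image_eqI[of _ _ "(k, v - scaleM k x)"]) auto
      qed
    qed
    ultimately have "card (matvs.span (insert x B)) = card (UNIV \<times> matvs.span B :: ('a \<times> _) set)"
      by (metis card_image)
    then show ?case
      using insert ind by (simp add: card_cartesian_product)
  qed
qed

lemma card_subspace:
  fixes U :: "('a::{field,finite}^'n^'m) set"
  assumes "matvs.subspace U"
  shows "card U = CARD('a) ^ matvs.dim U"
proof -
  obtain B where B: "B \<subseteq> U" "matvs.independent B" "U \<subseteq> matvs.span B" "card B = matvs.dim U"
    by (rule matvs.basis_exists)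
  then have "matvs.span B = U"
    using assms by (metis matvs.span_minimal subset_antisym)
  then show ?thesis
    using card_span_independent[OF B(2)] B(4) by simp
qed

section \<open>Rank and congruence of matrices\<close>

lemma symmetric_nth: "transpose M = M \<Longrightarrow> M $ i $ j = M $ j $ i"
  by (simp add: transpose_def vec_eq_iff)

lemma rank_le_2_if_det_0:
  fixes A :: "'a::field^3^3"
  assumes "det A = 0"
  shows "rank A \<le> 2"
proof (rule ccontr)
  assume "\<not> rank A \<le> 2"
  then have "vec.dim (UNIV :: ('a^3) set) \<le> vec.dim (rows A)"
    unfolding vec_dim_card by (simp add: row_rank_def_gen)
  then have "vec.span (rows A) = UNIV"
    using vec.dim_subset_UNIV[of "rows A"] vec.dim_eq_full[of "rows A"] by (simp add: vec.dimension_def)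
  then have "invertible A"
    by (metis invertible_left_inverse matrix_left_invertible_span_rows_gen)
  then show False
    using assms by (simp add: invertible_det_nz)
qed

text \<open>For nonzero \<open>v\<close> in dimension 3, these matrices represent the points of the
  Veronese surface.\<close>

definition outer :: "'a::field^'n \<Rightarrow> 'a^'n^'n"
  where "outer v = (\<chi> i j. v $ i * v $ j)"

lemma rank_outer_le_1: "rank (outer v) \<le> 1"
proof -
  have "row i (outer v) = v $ i *s v" for i
    by (simp add: row_def outer_def vec_eq_iff)
  then have "rows (outer v) \<subseteq> vec.span {v}"
    by (auto simp: rows_def vec.span_singleton)
  then have "vec.dim (rows (outer v)) \<le> card {v}"
    by (intro vec.dim_le_card) auto
  then show ?thesis
    by (simp add: row_rank_def_gen)
qed

lemma congruence_outer:
  "transpose Q ** outer v ** Q = outer (transpose Q *v (v :: 'a::field^3))"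
  by (simp add: vec_eq_iff outer_def matrix_matrix_mult_def matrix_vector_mult_def transpose_def
      sum_3 algebra_simps)

lemma congruence_scaleM:
  "transpose Q ** scaleM c M ** Q = scaleM c (transpose Q ** M ** (Q :: 'a::field^3^3))"
  by (simp add: vec_eq_iff scaleM_def matrix_matrix_mult_def transpose_def sum_3 algebra_simps)

lemma congruence_add:
  "transpose Q ** (M + N) ** Q = transpose Q ** M ** Q + transpose Q ** N ** (Q :: 'a::field^3^3)"
  by (simp add: vec_eq_iff matrix_matrix_mult_def transpose_def sum_3 algebra_simps)

lemma congruence_symmetric:
  "transpose M = M \<Longrightarrow> transpose (transpose Q ** M ** Q) = transpose Q ** M ** (Q :: 'a::field^3^3)"
  by (simp add: matrix_transpose_mul matrix_mul_assoc)

text \<open>The diagonal entries are the values x^T M x at the columns x of \<open>Q\<close>; the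
  off-diagonal terms occur in equal pairs and cancel.\<close>

lemma congruence_diagonal_0:
  fixes M Q :: "'a::field^3^3"
  assumes "(1::'a) + 1 = 0" "transpose M = M" "\<forall>i. M $ i $ i = 0"
  shows "(transpose Q ** M ** Q) $ i $ i = 0"
proof -
  have s: "M $ 2 $ 1 = M $ 1 $ 2" "M $ 3 $ 1 = M $ 1 $ 3" "M $ 3 $ 2 = M $ 2 $ 3"
    by (rule symmetric_nth[OF assms(2)])+
  show ?thesis
    using assms(3)
    by (simp add: matrix_matrix_mult_def transpose_def sum_3 s algebra_simps
        char_2_simps[OF assms(1)])
qed

section \<open>Normal form of the points of the nucleus plane\<close>

definition hyp :: "'a::field^3^3"
  where "hyp = vector [vector [0, 1, 0], vector [1, 0, 0], vector [0, 0, 0]]"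

lemma hyp_nth [simp]:
  "hyp $ 1 $ 1 = 0" "hyp $ 1 $ 2 = 1" "hyp $ 1 $ 3 = 0"
  "hyp $ 2 $ 1 = 1" "hyp $ 2 $ 2 = 0" "hyp $ 2 $ 3 = 0"
  "hyp $ 3 $ 1 = 0" "hyp $ 3 $ 2 = 0" "hyp $ 3 $ 3 = 0"
  by (simp_all add: hyp_def)

text \<open>The kernel of \<open>N\<close> is spanned by (d, e, f). With this as third column of
  \<open>P\<close>, only the pairing of the first two columns survives.\<close>

lemma nucleus_congruent_to_hyp:
  fixes N :: "'a::field^3^3"
  assumes "(1::'a) + 1 = 0" "N \<in> nucleus_plane" "N \<noteq> 0"
  obtains P c where "det P \<noteq> 0" "c \<noteq> 0" "transpose P ** N ** P = scaleM c hyp"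
proof -
  define d e f where "d = N $ 2 $ 3" and "e = N $ 1 $ 3" and "f = N $ 1 $ 2"
  have N: "N $ 1 $ 1 = 0" "N $ 2 $ 2 = 0" "N $ 3 $ 3 = 0"
    "N $ 2 $ 3 = d" "N $ 3 $ 2 = d" "N $ 1 $ 3 = e" "N $ 3 $ 1 = e" "N $ 1 $ 2 = f" "N $ 2 $ 1 = f"
    using assms(2) unfolding nucleus_plane_def d_def e_def f_def
    by (auto simp: transpose_def vec_eq_iff)
  \<comment> \<open>The columns of \<open>P\<close> are x, y and the kernel vector, and
    \<open>c\<close> is x^T N y.\<close>
  have cong: "transpose P ** N ** P = scaleM c hyp" if
    "P = vector [vector [x1, y1, d], vector [x2, y2, e], vector [x3, y3, f]]"
    "c = f * (x1 * y2 + x2 * y1) + e * (x1 * y3 + x3 * y1) + d * (x2 * y3 + x3 * y2)"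
    for P c x1 x2 x3 y1 y2 y3
    by (simp add: vec_eq_iff forall_3 scaleM_def matrix_matrix_mult_def transpose_def sum_3 N that
        algebra_simps char_2_simps[OF assms(1)])
  \<comment> \<open>With suitable unit vectors as x and y, \<open>c\<close> is the nonzero one of
    \<open>f\<close>, \<open>e\<close>, \<open>d\<close>, and \<open>det P\<close> equals
    \<open>c\<close> up to sign.\<close>
  consider "f \<noteq> 0" | "e \<noteq> 0" | "d \<noteq> 0"
    using assms(3) N by (auto simp: vec_eq_iff forall_3)
  then show ?thesis
  proof cases
    case 1
    show ?thesis
      by (rule that[OF _ _ cong[of _ 1 0 0 1 0 0]]) (use 1 in \<open>auto simp: det_3\<close>)
  next
    case 2
    show ?thesis
      by (rule that[OF _ _ cong[of _ 1 0 0 0 0 1]]) (use 2 in \<open>auto simp: det_3\<close>)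
  next
    case 3
    show ?thesis
      by (rule that[OF _ _ cong[of _ 0 0 1 0 0 1]]) (use 3 in \<open>auto simp: det_3\<close>)
  qed
qed

section \<open>Rank 1 points of solids through \<open>hyp\<close>\<close>

lemma outer_in_solid_through_hyp:
  fixes U S :: "('a::{field,finite}^3^3) set"
  assumes char: "(1::'a) + 1 = 0"
    and U: "matvs.subspace U" and S: "matvs.subspace S" and US: "U \<subseteq> S"
    and sym: "\<And>M. M \<in> S \<Longrightarrow> transpose M = M"
    and cardU: "card U = CARD('a) ^ 3" and cardS: "card S = CARD('a) ^ 4"
    and hypU: "hyp \<in> U"
    and sing: "\<And>M i. M \<in> U \<Longrightarrow> det M = 0 \<Longrightarrow> M $ i $ i = 0"
  obtains v where "outer v \<in> S" "outer v \<noteq> 0"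
proof -
  note char_2 = char_2_simps[OF char]
  have ent: "M $ 2 $ 1 = M $ 1 $ 2" "M $ 3 $ 1 = M $ 1 $ 3" "M $ 3 $ 2 = M $ 2 $ 3" if "M \<in> S" for M
    by (rule symmetric_nth[OF sym[OF that]])+
  have card_field: "CARD('a) > 1"
    using card_mono[of UNIV "{0, 1::'a}"] by simp
  have hyp_scale: "M = scaleM (M $ 1 $ 2) hyp"
    if "M \<in> S" "M $ 1 $ 1 = 0" "M $ 2 $ 2 = 0" "M $ 3 $ 3 = 0" "M $ 1 $ 3 = 0" "M $ 2 $ 3 = 0" for M
    using that ent[of M] by (simp add: vec_eq_iff forall_3 scaleM_def)
  have card_hyp_multiples: "card X \<le> CARD('a)"
    if "X \<subseteq> range (\<lambda>c::'a. scaleM c hyp)" for X :: "('a^3^3) set"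
    using that card_image_le[of UNIV "\<lambda>c::'a. scaleM c hyp"] card_mono[OF _ that] by simp
  have c0: "M $ 3 $ 3 = 0" if M: "M \<in> U" for M
  proof (rule ccontr)
    assume nz: "M $ 3 $ 3 \<noteq> 0"
    obtain t where t: "t * t = det M / M $ 3 $ 3"
      by (rule square_surj_char_2[OF char])
    let ?M = "M + scaleM t hyp"
    have "?M \<in> U"
      using M U hypU by (simp add: matvs.subspace_add matvs.subspace_scale)
    moreover have "det ?M = det M + t * t * M $ 3 $ 3"
      using ent[of M] M US by (simp add: subset_iff det_3 scaleM_def algebra_simps char_2)
    then have "det ?M = 0"
      using nz t by (simp add: char_2)
    ultimately have "?M $ 3 $ 3 = 0"
      by (rule sing)
    then show False
      using nz by (simp add: scaleM_def)
  qed
  show thesis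
  proof (cases "\<forall>M\<in>S. M $ 3 $ 3 = 0")
    case True
    let ?f = "\<lambda>M::'a^3^3. (M $ 1 $ 3, M $ 2 $ 3)"
    let ?K = "{M \<in> S. ?f M = 0}"
    have "CARD('a) ^ 4 \<le> card (?f ` S) * card ?K"
      unfolding cardS[symmetric]
      by (rule card_le_card_image_times_card_kernel) (use S in \<open>auto simp: matvs.subspace_diff\<close>)
    also have "\<dots> \<le> CARD('a \<times> 'a) * card ?K"
      by (intro mult_right_mono card_mono) auto
    finally have "CARD('a) ^ 2 \<le> card ?K"
      using card_field by (simp add: card_prod power2_eq_square eval_nat_numeral)
    \<comment> \<open>The kernel has at least q^2 > q elements, so the multiples of
      \<open>hyp\<close> cannot exhaust it.\<close>
    then have "\<not> card ?K \<le> CARD('a)"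
      using card_field by (auto simp: power2_eq_square dest: order_trans)
    then obtain M where M: "M \<in> S" "M $ 1 $ 3 = 0" "M $ 2 $ 3 = 0" "M \<notin> range (\<lambda>c. scaleM c hyp)"
      using card_hyp_multiples[of ?K] by (auto simp: zero_prod_def)
    obtain x where x: "x * x = M $ 1 $ 1"
      by (rule square_surj_char_2[OF char])
    obtain y where y: "y * y = M $ 2 $ 2"
      by (rule square_surj_char_2[OF char])
    let ?v = "vector [x, y, 0] :: 'a^3"
    \<comment> \<open>The third row of \<open>M\<close> is zero and its diagonal consists of
      squares; the multiple of \<open>hyp\<close> corrects the remaining entry to
      \<open>x * y\<close>.\<close>
    have "outer ?v = M + scaleM (x * y - M $ 1 $ 2) hyp"
      using x y M ent[of M] True by (simp add: vec_eq_iff forall_3 outer_def scaleM_def)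
    then have "outer ?v \<in> S"
      using M(1) S US hypU by (auto intro!: matvs.subspace_add matvs.subspace_scale)
    moreover have "x \<noteq> 0 \<or> y \<noteq> 0"
      using hyp_scale[OF M(1) _ _ _ M(2,3)] x y M(1,4) True by auto
    then have "outer ?v \<noteq> 0"
      by (auto simp: vec_eq_iff forall_3 outer_def)
    ultimately show thesis
      by (rule that)
  next
    case False
    then obtain R0 where R0: "R0 \<in> S" "R0 $ 3 $ 3 \<noteq> 0"
      by blast
    define R where "R = scaleM (1 / R0 $ 3 $ 3) R0"
    have R: "R \<in> S" "R $ 3 $ 3 = 1"
      using R0 S by (simp_all add: R_def matvs.subspace_scale) (simp add: scaleM_def)
    let ?f = "\<lambda>M::'a^3^3. (M $ 1 $ 1 + M $ 1 $ 3 * M $ 1 $ 3, M $ 2 $ 2 + M $ 2 $ 3 * M $ 2 $ 3)"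
    let ?K = "{M \<in> U. ?f M = 0}"
    \<comment> \<open>\<open>?f\<close> is additive because squaring is, but it is not linear; hence
      the use of cardinalities instead of dimensions.\<close>
    have sq: "x - x' + (y - y') * (y - y') = x + y * y - (x' + y' * y')" for x x' y y' :: 'a
      by (simp add: algebra_simps char_2)
    have "card U \<le> card (?f ` U) * card ?K"
      by (rule card_le_card_image_times_card_kernel) (use U in \<open>auto simp: matvs.subspace_diff sq\<close>)
    also have "card ?K \<le> CARD('a)"
    proof (intro card_hyp_multiples subsetI)
      fix M assume "M \<in> ?K"
      then have M: "M \<in> U" "M $ 1 $ 1 = M $ 1 $ 3 * M $ 1 $ 3" "M $ 2 $ 2 = M $ 2 $ 3 * M $ 2 $ 3"
        by (auto simp: zero_prod_def add_eq_0_iff2 char_2)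
      \<comment> \<open>With \<open>M $ 3 $ 3 = 0\<close> the determinant is M11 M23^2 + M22 M13^2,
        here a sum of two equal terms.\<close>
      then have "det M = 0"
        using c0[of M] ent[of M] US by (simp add: subset_iff det_3 algebra_simps char_2)
      then have "M $ 1 $ 1 = 0" "M $ 2 $ 2 = 0"
        using sing M(1) by auto
      then show "M \<in> range (\<lambda>c. scaleM c hyp)"
        using hyp_scale[of M] M c0 US by auto
    qed
    finally have "CARD('a \<times> 'a) \<le> card (?f ` U)"
      using card_field by (simp add: cardU card_prod eval_nat_numeral)
    then have "?f ` U = UNIV"
      by (intro card_seteq) auto
    then obtain M where M: "M \<in> U" "?f M = ?f R"
      by (metis (no_types, lifting) UNIV_I imageE)
    have balance: "x + x' = (y + y') * (y + y')" if "x + y * y = x' + y' * y'" for x x' y y' :: 'a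
    proof -
      have "x = x' + y' * y' - y * y"
        using that by (simp only: eq_diff_eq)
      then show ?thesis
        by (simp add: algebra_simps char_2)
    qed
    \<comment> \<open>\<open>?f M = ?f R\<close> becomes \<open>?f T = 0\<close>. So
      \<open>T\<close> agrees with \<open>outer ?v\<close> below, except possibly at (1,2) and
      (2,1), where a multiple of \<open>hyp\<close> corrects it.\<close>
    define T where "T = M + R"
    have T: "T \<in> S" "T $ 3 $ 3 = 1"
      using M(1) R S US c0 by (auto simp: T_def matvs.subspace_add)
    have T': "T $ 1 $ 1 = T $ 1 $ 3 * T $ 1 $ 3" "T $ 2 $ 2 = T $ 2 $ 3 * T $ 2 $ 3"
      unfolding T_def vector_add_component by (rule balance; use M(2) in simp)+
    let ?v = "vector [T $ 1 $ 3, T $ 2 $ 3, 1] :: 'a^3"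
    have "outer ?v = T + scaleM (T $ 1 $ 3 * T $ 2 $ 3 - T $ 1 $ 2) hyp"
      using T T' ent[of T] by (simp add: vec_eq_iff forall_3 outer_def scaleM_def)
    then have "outer ?v \<in> S"
      using T(1) S US hypU by (auto intro!: matvs.subspace_add matvs.subspace_scale)
    moreover have "outer ?v \<noteq> 0"
      by (auto simp: vec_eq_iff forall_3 outer_def)
    ultimately show thesis
      by (rule that)
  qed
qed

section \<open>Reduction to \<open>hyp\<close> by congruence\<close>

lemma subspace_congruence:
  fixes U :: "('a::field^3^3) set" and P :: "'a^3^3"
  assumes "matvs.subspace U"
  shows "matvs.subspace ((\<lambda>M. transpose P ** M ** P) ` U)"
proof (rule matvs.subspaceI)
  show "0 \<in> (\<lambda>M. transpose P ** M ** P) ` U"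
    using assms by (intro image_eqI[of _ _ 0]) (simp_all add: matvs.subspace_0)
next
  fix A B
  assume "A \<in> (\<lambda>M. transpose P ** M ** P) ` U" "B \<in> (\<lambda>M. transpose P ** M ** P) ` U"
  then show "A + B \<in> (\<lambda>M. transpose P ** M ** P) ` U"
    using matvs.subspace_add[OF assms] by (auto simp flip: congruence_add)
next
  fix A c
  assume "A \<in> (\<lambda>M. transpose P ** M ** P) ` U"
  then show "scaleM c A \<in> (\<lambda>M. transpose P ** M ** P) ` U"
    using matvs.subspace_scale[OF assms] by (auto simp flip: congruence_scaleM)
qed

lemma outer_in_solid_through_nucleus_point:
  fixes U S :: "('a::{field,finite}^3^3) set"
  assumes char: "(1::'a) + 1 = 0"
    and U: "matvs.subspace U" and S: "matvs.subspace S" and US: "U \<subseteq> S"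
    and sym: "\<And>M. M \<in> S \<Longrightarrow> transpose M = M"
    and cardU: "card U = CARD('a) ^ 3" and cardS: "card S = CARD('a) ^ 4"
    and N: "N \<in> U" "N \<in> nucleus_plane" "N \<noteq> 0"
    and sing: "\<And>M i. M \<in> U \<Longrightarrow> det M = 0 \<Longrightarrow> M $ i $ i = 0"
  obtains v where "outer v \<in> S" "outer v \<noteq> 0"
proof -
  obtain P c where P: "det P \<noteq> 0" and c: "c \<noteq> 0" and PN: "transpose P ** N ** P = scaleM c hyp"
    using nucleus_congruent_to_hyp[OF char N(2,3)] by blast
  obtain Q where PQ: "P ** Q = mat 1"
    using P unfolding invertible_det_nz[symmetric] invertible_def by blast
  let ?f = "\<lambda>M. transpose P ** M ** P"
  have PQ_cancel: "transpose Q ** ?f M ** Q = M" for M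
  proof -
    have "transpose Q ** ?f M ** Q = transpose (P ** Q) ** M ** (P ** Q)"
      by (simp add: matrix_transpose_mul matrix_mul_assoc)
    then show ?thesis
      by (simp add: PQ)
  qed
  then have inj: "inj ?f"
    by (metis (no_types, lifting) injI)
  obtain v where v: "outer v \<in> ?f ` S" "outer v \<noteq> 0"
  proof (rule outer_in_solid_through_hyp[OF char subspace_congruence[OF U] subspace_congruence[OF S]])
    show "?f ` U \<subseteq> ?f ` S"
      using US by blast
    show "transpose M = M" if "M \<in> ?f ` S" for M
      using that sym by (auto simp: congruence_symmetric)
    show "card (?f ` U) = CARD('a) ^ 3" "card (?f ` S) = CARD('a) ^ 4"
      using inj cardU cardS by (simp_all add: card_image inj_on_subset)
    have "?f (scaleM (inverse c) N) = hyp"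
      using c by (simp add: congruence_scaleM PN)
    then show "hyp \<in> ?f ` U"
      using matvs.subspace_scale[OF U N(1)] by (metis imageI)
    \<comment> \<open>As \<open>det P \<noteq> 0\<close>, a singular image comes from a singular
      matrix of \<open>U\<close>, whose zero diagonal survives the congruence.\<close>
    show "M $ i $ i = 0" if "M \<in> ?f ` U" "det M = 0" for M i
      using that sing sym US P char
      by (auto simp: det_mul congruence_diagonal_0 subset_iff)
  qed (use that in blast)
  then obtain M where M: "M \<in> S" "outer v = ?f M"
    by blast
  then have "M = outer (transpose Q *v v)"
    unfolding congruence_outer[symmetric] by (simp only: PQ_cancel)
  moreover have "M \<noteq> 0"
    using M v by auto
  ultimately show thesis
    using that M(1) by blast
qed

section \<open>Contradiction with minimum rank 2\<close>

theorem theorem3p10: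
  fixes \<pi> :: "('a::{field,finite}^3^3) set"
  assumes "even CARD('a)"
    and "CARD('a) \<ge> 4"
    and "pg_plane \<pi>"
    and "\<forall>P\<in>pg_points \<pi>. point_rank P \<noteq> 1"
    and "\<exists>W. pg_subspace W \<and> pg_points W \<noteq> {} \<and> W \<subseteq> nucleus_plane \<and>
           {P \<in> pg_points \<pi>. point_rank P \<le> 2} = pg_points W"
  shows "\<not> (\<exists>S. pg_solid S \<and> has_min_rank S 2 \<and> \<pi> \<subseteq> S)"
proof
  assume "\<exists>S. pg_solid S \<and> has_min_rank S 2 \<and> \<pi> \<subseteq> S"
  then obtain S where S: "matvs.subspace S" "\<And>M. M \<in> S \<Longrightarrow> transpose M = M" "matvs.dim S = 4"
    and min: "has_min_rank S 2" and sub: "\<pi> \<subseteq> S"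
    by (auto simp: pg_solid_def pg_subspace_def)
  have \<pi>: "matvs.subspace \<pi>" "matvs.dim \<pi> = 3"
    using assms(3) by (auto simp: pg_plane_def pg_subspace_def)
  obtain W where W: "matvs.subspace W" "pg_points W \<noteq> {}" "W \<subseteq> nucleus_plane"
    and eq: "{P \<in> pg_points \<pi>. point_rank P \<le> 2} = pg_points W"
    using assms(5) by (auto simp: pg_subspace_def)
  \<comment> \<open>\<open>pg_points\<close> provides some generator of the point in
    \<open>X\<close>; closure under scaling passes membership on to \<open>M\<close>.\<close>
  have point_mem: "M \<in> X" if "matvs.span {M} \<in> pg_points X" "matvs.subspace X" for M and X :: "('a^3^3) set"
  proof -
    from that(1) obtain B where "B \<in> X" "matvs.span {M} = matvs.span {B}"
      by (auto simp: pg_points_def)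
    then show ?thesis
      using that(2) matvs.span_base[of M "{M}"] matvs.span_minimal[of "{B}" X] by auto
  qed
  obtain N where N: "N \<in> W" "N \<noteq> 0" "matvs.span {N} \<in> pg_points W"
    using W(2) by (auto simp: pg_points_def)
  have "N \<in> \<pi>"
    using N(3) point_mem[OF _ \<pi>(1)] unfolding eq[symmetric] by blast
  \<comment> \<open>A nonzero singular \<open>M\<close> spans a point of rank at most 2, hence a
    point of \<open>W\<close>; the zero matrix spans no point and is treated separately.\<close>
  have sing: "M $ i $ i = 0" if "M \<in> \<pi>" "det M = 0" for M i
  proof (cases "M = 0")
    case False
    then have "matvs.span {M} \<in> {P \<in> pg_points \<pi>. point_rank P \<le> 2}"
      using that by (auto simp: pg_points_def point_rank_span rank_le_2_if_det_0)
    then have "M \<in> W"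
      using point_mem[OF _ W(1)] eq by blast
    then show ?thesis
      using W(3) by (auto simp: nucleus_plane_def)
  qed simp
  obtain v where v: "outer v \<in> S" "outer v \<noteq> 0"
    by (rule outer_in_solid_through_nucleus_point[OF one_plus_one_if_even_card[OF assms(1)]
          \<pi>(1) S(1) sub S(2) _ _ \<open>N \<in> \<pi>\<close> _ N(2) sing])
      (use card_subspace[OF \<pi>(1)] card_subspace[OF S(1)] \<pi>(2) S(3) N(1) W(3) in auto)
  then have "2 \<le> rank (outer v)"
    using min by (auto simp: has_min_rank_def pg_points_def point_rank_span)
  then show False
    using rank_outer_le_1[of v] by simp
qed

end
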